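(* If $G$ is a finite group then \[ \Pr(G) \geq \frac{1}{|K(G)|}\left(1 + \frac{|K(G)| - 1}{|G : Z(G)|}\right). \] In particular, if $G$ is non-abelian, then $\Pr(G) > \frac{1}{|K(G)|}$.
   Context: For a finite group $G$: $[x,y] := xyx^{-1}y^{-1}$; $K(G) := \{[x,y] : x,y\in G\}$ is the set (not the generated subgroup) of all commutators in $G$; $Z(G)$ is the center of $G$. The commutativity degree of $G$ is \[ \Pr(G) := \frac{|\{(x,y)\in G\times G : xy = yx\}|}{|G|^2}. \] *)

theory Defs
  imports Complex_Main "HOL-Algebra.Algebra"
begin

text \<open>
  The library's \<open>derived_set\<close> uses the convention \<open>[x,y] = x y x\<^sup>-\<^sup>1 y\<^sup>-\<^sup>1\<close> and collects the
  commutators themselves; it is \<open>derived\<close> that forms the generated subgroup.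
\<close>

abbreviation commutator_set :: "('a, 'b) monoid_scheme \<Rightarrow> 'a set"
  where "commutator_set G \<equiv> derived_set G (carrier G)"

definition group_center :: "('a, 'b) monoid_scheme \<Rightarrow> 'a set"
  where "group_center G =
    {z \<in> carrier G. \<forall>x \<in> carrier G. z \<otimes>\<^bsub>G\<^esub> x = x \<otimes>\<^bsub>G\<^esub> z}"

definition commutativity_degree :: "('a, 'b) monoid_scheme \<Rightarrow> real"
  where "commutativity_degree G =
    real (card {(x, y) \<in> carrier G \<times> carrier G. x \<otimes>\<^bsub>G\<^esub> y = y \<otimes>\<^bsub>G\<^esub> x})
      / (real (order G))\<^sup>2"

definition subgroup_index :: "('a, 'b) monoid_scheme \<Rightarrow> 'a set \<Rightarrow> nat"
  where "subgroup_index G H = card (rcosets\<^bsub>G\<^esub> H)"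

end

theory Submission
  imports Defs
begin

text \<open>
  Counting commuting pairs by their first entry writes the numerator of the commutativity degree
  as the sum of the orders of all centralizers. For fixed \<open>x\<close>, the map \<open>y \<mapsto> [x,y]\<close> has the left
  cosets of the centralizer of \<open>x\<close> as its nonempty fibres and takes values in \<open>K(G)\<close>; hence every
  centralizer has at least \<open>|G| / |K(G)|\<close> elements (\<open>order_le_card_commutators_times_centralizer\<close>).
  The elements of \<open>Z(G)\<close> do better: each of them contributes \<open>|G|\<close>. Therefore the number of
  commuting pairs is at least \<open>|Z(G)| * |G| + (|G| - |Z(G)|) * |G| / |K(G)|\<close>, and division by the
  square of \<open>|G|\<close> together with Lagrange's theorem for \<open>Z(G)\<close> gives the bound.

  If \<open>G\<close> is not abelian, there is a commutator other than \<open>\<one>\<close>, so \<open>|K(G)| - 1\<close> is positive and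
  the term with the index of the center makes the bound exceed \<open>1 / |K(G)|\<close>.
\<close>

context group
begin

definition centralizer :: "'a \<Rightarrow> 'a set"
  where "centralizer x = {y \<in> carrier G. x \<otimes> y = y \<otimes> x}"

lemma centralizer_subset_carrier: "centralizer x \<subseteq> carrier G"
  by (auto simp: centralizer_def)

lemma centralizer_of_central:
  assumes "z \<in> group_center G"
  shows "centralizer z = carrier G"
  using assms by (auto simp: centralizer_def group_center_def)

lemma center_subgroup: "subgroup (group_center G) G"
proof (rule subgroupI)
  show "group_center G \<subseteq> carrier G"
    by (auto simp: group_center_def)
  have "\<one> \<in> group_center G"
    by (auto simp: group_center_def)
  then show "group_center G \<noteq> {}"
    by blast
next
  fix a assume a: "a \<in> group_center G"
  then have aG: "a \<in> carrier G"
    by (simp add: group_center_def)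
  have "inv a \<otimes> x = x \<otimes> inv a" if x: "x \<in> carrier G" for x
  proof -
    have "a \<otimes> x = x \<otimes> a"
      using a x unfolding group_center_def by blast
    then have "inv a \<otimes> (a \<otimes> x) \<otimes> inv a = inv a \<otimes> (x \<otimes> a) \<otimes> inv a"
      by (rule arg_cong)
    moreover have "inv a \<otimes> (a \<otimes> x) \<otimes> inv a = x \<otimes> inv a"
      using aG x by (simp flip: m_assoc)
    moreover have "inv a \<otimes> (x \<otimes> a) \<otimes> inv a = inv a \<otimes> x"
      using aG x by (simp add: m_assoc)
    ultimately show ?thesis
      by simp
  qed
  then show "inv a \<in> group_center G"
    using aG by (simp add: group_center_def)
next
  fix a b assume a: "a \<in> group_center G" and b: "b \<in> group_center G"
  then have abG: "a \<in> carrier G" "b \<in> carrier G"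
    by (simp_all add: group_center_def)
  have "a \<otimes> b \<otimes> x = x \<otimes> (a \<otimes> b)" if x: "x \<in> carrier G" for x
  proof -
    have "a \<otimes> b \<otimes> x = a \<otimes> (b \<otimes> x)"
      using abG x by (rule m_assoc)
    also have "b \<otimes> x = x \<otimes> b"
      using b x unfolding group_center_def by blast
    also have "a \<otimes> (x \<otimes> b) = a \<otimes> x \<otimes> b"
      using abG x by (simp add: m_assoc)
    also have "a \<otimes> x = x \<otimes> a"
      using a x unfolding group_center_def by blast
    also have "x \<otimes> a \<otimes> b = x \<otimes> (a \<otimes> b)"
      using abG x by (simp add: m_assoc)
    finally show ?thesis .
  qed
  then show "a \<otimes> b \<in> group_center G"
    using abG by (simp add: group_center_def)
qed

lemma commutator_eq_one_iff:
  assumes "x \<in> carrier G" "y \<in> carrier G"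
  shows "x \<otimes> y \<otimes> inv x \<otimes> inv y = \<one> \<longleftrightarrow> x \<otimes> y = y \<otimes> x"
proof -
  have "x \<otimes> y \<otimes> inv x \<otimes> inv y = x \<otimes> y \<otimes> inv (y \<otimes> x)"
    using assms by (simp add: inv_mult_group m_assoc)
  then show ?thesis
    using assms by (simp add: inv_solve_right')
qed

text \<open>
  Cancelling the leading \<open>x\<close> turns \<open>[x,y] = [x,z]\<close> into the statement that \<open>y\<close> and \<open>z\<close> conjugate \<open>x\<^sup>-\<^sup>1\<close>, hence
  \<open>x\<close>, to the same element, so they differ on the right by a factor fixing \<open>x\<close>.
\<close>

lemma commutator_eq_imp_centralizer:
  assumes x: "x \<in> carrier G" and y: "y \<in> carrier G" and z: "z \<in> carrier G"
    and eq: "x \<otimes> y \<otimes> inv x \<otimes> inv y = x \<otimes> z \<otimes> inv x \<otimes> inv z"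
  shows "inv z \<otimes> y \<in> centralizer x"
proof -
  have "y \<otimes> inv x \<otimes> inv y = z \<otimes> inv x \<otimes> inv z"
    using eq x y z by (simp add: m_assoc)
  then have "inv (y \<otimes> inv x \<otimes> inv y) = inv (z \<otimes> inv x \<otimes> inv z)"
    by simp
  then have "y \<otimes> (x \<otimes> inv y) = z \<otimes> (x \<otimes> inv z)"
    using x y z by (simp add: inv_mult_group m_assoc)
  then have "inv z \<otimes> (y \<otimes> (x \<otimes> inv y)) \<otimes> y = inv z \<otimes> (z \<otimes> (x \<otimes> inv z)) \<otimes> y"
    by (rule arg_cong)
  moreover have "inv z \<otimes> (y \<otimes> (x \<otimes> inv y)) \<otimes> y = inv z \<otimes> y \<otimes> x"
    using x y z by (simp add: m_assoc)
  moreover have "inv z \<otimes> (z \<otimes> (x \<otimes> inv z)) \<otimes> y = x \<otimes> (inv z \<otimes> y)"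
    using x y z by (simp flip: m_assoc)
  ultimately have "inv z \<otimes> y \<otimes> x = x \<otimes> (inv z \<otimes> y)"
    by simp
  then show ?thesis
    using y z by (simp add: centralizer_def)
qed

lemma finite_commutator_set:
  assumes "finite (carrier G)"
  shows "finite (commutator_set G)"
  using assms by simp

lemma one_in_commutator_set: "\<one> \<in> commutator_set G"
  by (auto intro!: bexI[of _ \<one>])

lemma card_commutator_set_pos:
  assumes "finite (carrier G)"
  shows "card (commutator_set G) > 0"
proof -
  have "commutator_set G \<noteq> {}"
    using one_in_commutator_set by (rule ex_in_conv[THEN iffD1, OF exI])
  with finite_commutator_set[OF assms] show ?thesis
    by (intro card_gt_0_iff[THEN iffD2] conjI)
qed

lemma order_le_card_commutators_times_centralizer:
  assumes fin: "finite (carrier G)" and x: "x \<in> carrier G"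
  shows "order G \<le> card (commutator_set G) * card (centralizer x)"
proof -
  define fibre where
    "fibre c = {y \<in> carrier G. x \<otimes> y \<otimes> inv x \<otimes> inv y = c}" for c
  have fibre_le: "card (fibre c) \<le> card (centralizer x)" for c
  proof (cases "fibre c = {}")
    case False
    then obtain z where z: "z \<in> fibre c"
      by blast
    \<comment> \<open>Translating by one member of the fibre moves the whole fibre into the centralizer.\<close>
    have "(\<lambda>y. inv z \<otimes> y) ` fibre c \<subseteq> centralizer x"
      using z x by (auto simp: fibre_def intro!: commutator_eq_imp_centralizer)
    moreover have "inj_on (\<lambda>y. inv z \<otimes> y) (fibre c)"
      using z by (auto simp: fibre_def inj_on_def)
    moreover have "finite (centralizer x)"
      using fin centralizer_subset_carrier finite_subset by blast
    ultimately show ?thesis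
      by (meson card_inj_on_le)
  qed simp
  have finK: "finite (commutator_set G)"
    using fin by (rule finite_commutator_set)
  have "carrier G \<subseteq> (\<Union>c\<in>commutator_set G. fibre c)"
    using x by (fastforce simp: fibre_def)
  moreover have "finite (\<Union>c\<in>commutator_set G. fibre c)"
    using fin finK by (auto simp: fibre_def)
  ultimately have "order G \<le> card (\<Union>c\<in>commutator_set G. fibre c)"
    unfolding order_def by (rule card_mono[rotated])
  also have "\<dots> \<le> (\<Sum>c\<in>commutator_set G. card (fibre c))"
    using finK by (rule card_UN_le)
  also have "\<dots> \<le> card (commutator_set G) * card (centralizer x)"
    using sum_bounded_above[of "commutator_set G" "\<lambda>c. card (fibre c)"] fibre_le by simp
  finally show ?thesis .
qed

lemma card_commuting_pairs:
  assumes "finite (carrier G)"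
  shows "card {(x, y) \<in> carrier G \<times> carrier G. x \<otimes> y = y \<otimes> x}
           = (\<Sum>x\<in>carrier G. card (centralizer x))"
proof -
  have "{(x, y) \<in> carrier G \<times> carrier G. x \<otimes> y = y \<otimes> x} = Sigma (carrier G) centralizer"
    by (auto simp: centralizer_def)
  moreover have "finite (centralizer x)" for x
    using assms centralizer_subset_carrier finite_subset by blast
  ultimately show ?thesis
    using assms by (simp add: card_SigmaI)
qed

lemma card_commutator_set_gt_1:
  assumes fin: "finite (carrier G)" and "\<not> comm_group G"
  shows "card (commutator_set G) > 1"
proof (rule ccontr)
  assume "\<not> card (commutator_set G) > 1"
  then have "card (commutator_set G) \<le> Suc 0"
    by (simp only: not_less One_nat_def)
  then have all_eq: "\<forall>c\<in>commutator_set G. \<forall>d\<in>commutator_set G. c = d"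
    by (rule card_le_Suc0_iff_eq[OF finite_commutator_set[OF fin], THEN iffD1])
  have trivial: "c = \<one>" if "c \<in> commutator_set G" for c
  proof -
    have "\<forall>d\<in>commutator_set G. c = d"
      using all_eq that by (rule bspec)
    then show ?thesis
      using one_in_commutator_set by (rule bspec)
  qed
  have "x \<otimes> y = y \<otimes> x" if "x \<in> carrier G" "y \<in> carrier G" for x y
  proof -
    have "x \<otimes> y \<otimes> inv x \<otimes> inv y = \<one>"
      by (rule trivial) (use that in blast)
    then show ?thesis
      using that by (simp only: commutator_eq_one_iff)
  qed
  then have "comm_group G"
    by (rule group_comm_groupI)
  with assms show False
    by simp
qed

end

theorem corollary3p3:
  fixes G :: "('a, 'b) monoid_scheme"
  assumes "group G" and "finite (carrier G)"
  shows "commutativity_degree G \<ge>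
           1 / real (card (commutator_set G)) *
             (1 + (real (card (commutator_set G)) - 1)
                    / real (subgroup_index G (group_center G)))
         \<and> (\<not> comm_group G \<longrightarrow>
              commutativity_degree G > 1 / real (card (commutator_set G)))"
proof -
  interpret group G by fact
  note fin = assms(2)
  define Z where "Z = group_center G"
  define n where "n = real (order G)"
  define k where "k = real (card (commutator_set G))"
  define z where "z = real (card Z)"
  define i where "i = real (subgroup_index G Z)"
  have Zsub: "Z \<subseteq> carrier G"
    by (auto simp: Z_def group_center_def)
  have n_pos: "n > 0"
    using fin by (simp add: n_def order_gt_0_iff_finite)
  have k_pos: "k > 0"
    using card_commutator_set_pos[OF fin] unfolding k_def by (rule of_nat_0_less_iff[THEN iffD2])
  have "card (rcosets\<^bsub>G\<^esub> Z) * card Z = order G"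
    using lagrange[OF center_subgroup] by (simp add: Z_def)
  then have lagrange_center: "i * z = n"
    unfolding i_def z_def n_def subgroup_index_def by (metis of_nat_mult)
  then have i_nz: "i \<noteq> 0" and z_nz: "z \<noteq> 0"
    using n_pos by auto
  have i_pos: "i > 0"
    using i_nz by (simp add: i_def)
  have centralizer_ge: "n / k \<le> real (card (centralizer x))" if "x \<in> carrier G" for x
  proof -
    have "n \<le> k * real (card (centralizer x))"
      using order_le_card_commutators_times_centralizer[OF fin that]
      unfolding n_def k_def of_nat_mult[symmetric] by (rule of_nat_mono)
    then show ?thesis
      using k_pos by (simp add: divide_le_eq mult.commute)
  qed
  have "(n - z) * (n / k) + z * n
          = (\<Sum>x\<in>carrier G - Z. n / k) + (\<Sum>x\<in>Z. n)"
    using fin Zsub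
    by (simp add: n_def z_def order_def card_Diff_subset finite_subset of_nat_diff card_mono)
  also have "\<dots> \<le> (\<Sum>x\<in>carrier G - Z. real (card (centralizer x)))
                   + (\<Sum>x\<in>Z. real (card (centralizer x)))"
    using centralizer_ge
    by (intro add_mono sum_mono) (auto simp: centralizer_of_central Z_def n_def order_def)
  also have "\<dots> = (\<Sum>x\<in>carrier G. real (card (centralizer x)))"
    using fin Zsub by (simp add: sum.subset_diff)
  finally have "((n - z) * (n / k) + z * n) / n\<^sup>2 \<le> commutativity_degree G"
    unfolding commutativity_degree_def card_commuting_pairs[OF fin] of_nat_sum n_def
    by (rule divide_right_mono) simp
  moreover have "((n - z) * (n / k) + z * n) / n\<^sup>2 = 1 / k * (1 + (k - 1) / i)"
  proof -
    have "((n - z) * (n / k) + z * n) / n\<^sup>2 = (1 - z / n) / k + z / n"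
      using n_pos k_pos by (simp add: field_simps power2_eq_square)
    also have "z / n = 1 / i"
      using z_nz by (simp flip: lagrange_center)
    also have "(1 - 1 / i) / k + 1 / i = 1 / k * (1 + (k - 1) / i)"
      using i_pos k_pos by (simp add: field_simps)
    finally show ?thesis .
  qed
  ultimately have bound: "1 / k * (1 + (k - 1) / i) \<le> commutativity_degree G"
    by simp
  moreover have "1 / k < commutativity_degree G" if "\<not> comm_group G"
  proof -
    have "real 1 < k"
      using card_commutator_set_gt_1[OF fin that]
      unfolding k_def by (rule of_nat_less_iff[THEN iffD2])
    then have "1 / k * 1 < 1 / k * (1 + (k - 1) / i)"
      using i_pos k_pos by (intro mult_strict_left_mono) simp_all
    with bound show ?thesis
      by simp
  qed
  ultimately show ?thesis
    unfolding k_def i_def Z_def by (intro conjI impI)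
qed

end
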